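(* Let $\nu$ be a finite positive discrete measure on the unit circle $\mathbb{T}$. For any bijective map $\sigma:\mathbb{Z}\to\mathbb{N}$, let $f_n=z^{\sigma^{-1}(n)}$ for $n\in\mathbb{N}$. Then $\{f_n\}_{n=1}^{\infty}$ is not a Schauder basis of $L^{2}(\mathbb{T},\nu)$.
   Context: $\mathbb{T}=\{z\in\mathbb{C}:|z|=1\}$ and $\mathbb{N}=\{1,2,3,\dots\}$. A (Borel) measure on $\mathbb{T}$ is discrete if it is concentrated on a countable set $E$, i.e. $\nu(\mathbb{T}\setminus E)=0$. For $m\in\mathbb{Z}$, $z^{m}$ denotes the function $z\mapsto z^m$ on $\mathbb{T}$, viewed as an element of $L^2(\mathbb{T},\nu)$. A sequence $\{f_n\}_{n=1}^{\infty}$ in a Hilbert space $\mathcal{H}$ is a Schauder basis if for every $x\in\mathcal{H}$ there exists a unique sequence $\{\alpha_n\}_{n=1}^{\infty}$ of complex numbers such that $\sum_{n=1}^{k}\alpha_n f_n$ converges to $x$ in norm as $k\to\infty$. *)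

theory Defs
  imports "HOL-Analysis.Analysis"
begin

text \<open>
  Since \<open>L\<^sup>2(M)\<close> depends on the measure \<open>M\<close>, it cannot be a type; complex normed spaces are
  therefore given by an explicit carrier and operations.
\<close>

record 'v cnspace =
  points :: "'v set"
  vzero :: 'v
  vadd :: "'v \<Rightarrow> 'v \<Rightarrow> 'v"
  vscale :: "complex \<Rightarrow> 'v \<Rightarrow> 'v"
  vnorm :: "'v \<Rightarrow> real"

text \<open>\<open>partial_sum H a f k\<close> is \<open>a 1 f 1 + \<dots> + a k f k\<close>; the index 0 is not used.\<close>

primrec partial_sum ::
  "('v, 'm) cnspace_scheme \<Rightarrow> (nat \<Rightarrow> complex) \<Rightarrow> (nat \<Rightarrow> 'v) \<Rightarrow> nat \<Rightarrow> 'v" where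
  "partial_sum H a f 0 = vzero H"
| "partial_sum H a f (Suc k) =
     vadd H (partial_sum H a f k) (vscale H (a (Suc k)) (f (Suc k)))"

definition vdist :: "('v, 'm) cnspace_scheme \<Rightarrow> 'v \<Rightarrow> 'v \<Rightarrow> real" where
  "vdist H x y = vnorm H (vadd H x (vscale H (-1) y))"

text \<open>
  Sequences are indexed by \<open>{1, 2, 3, \<dots>}\<close>. The coefficient sequences are taken in
  \<open>extensional {1..}\<close>, which fixes the irrelevant value at 0: without this no coefficient
  sequence would ever be unique.
\<close>

definition schauder_basis :: "('v, 'm) cnspace_scheme \<Rightarrow> (nat \<Rightarrow> 'v) \<Rightarrow> bool" where
  "schauder_basis H f \<longleftrightarrow>
     (\<forall>n\<ge>1. f n \<in> points H) \<and>
     (\<forall>x\<in>points H. \<exists>!a. a \<in> extensional {1..} \<and>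
        (\<lambda>k. vdist H (partial_sum H a f k) x) \<longlonglongrightarrow> 0)"

definition square_integrable :: "'a measure \<Rightarrow> ('a \<Rightarrow> complex) \<Rightarrow> bool" where
  "square_integrable M f \<longleftrightarrow>
     f \<in> borel_measurable M \<and> integrable M (\<lambda>x. (cmod (f x))\<^sup>2)"

text \<open>The element of \<open>L\<^sup>2(M)\<close> represented by a square integrable function \<open>f\<close>.\<close>

definition L2_class :: "'a measure \<Rightarrow> ('a \<Rightarrow> complex) \<Rightarrow> ('a \<Rightarrow> complex) set" where
  "L2_class M f = {g. square_integrable M g \<and> (AE x in M. g x = f x)}"

definition rep :: "'b set \<Rightarrow> 'b" where
  "rep X = (SOME f. f \<in> X)"

text \<open>
  The operations are defined through representatives; the lemmas below show that they do not
  depend on the choice made by \<open>rep\<close>.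
\<close>

definition L2_space :: "'a measure \<Rightarrow> ('a \<Rightarrow> complex) set cnspace" where
  "L2_space M = \<lparr>
     points = L2_class M ` {f. square_integrable M f},
     vzero = L2_class M (\<lambda>_. 0),
     vadd = (\<lambda>X Y. L2_class M (\<lambda>x. rep X x + rep Y x)),
     vscale = (\<lambda>c X. L2_class M (\<lambda>x. c * rep X x)),
     vnorm = (\<lambda>X. sqrt (LINT x|M. (cmod (rep X x))\<^sup>2)) \<rparr>"

text \<open>\<open>E \<in> sets M\<close> is automatic for countable \<open>E \<subseteq> space M\<close> when singletons are measurable.\<close>

definition discrete_measure :: "'a measure \<Rightarrow> bool" where
  "discrete_measure M \<longleftrightarrow>
     (\<exists>E\<in>sets M. countable E \<and> emeasure M (space M - E) = 0)"

lemma L2_class_eq_iff: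
  assumes "square_integrable M f" "square_integrable M g"
  shows "L2_class M f = L2_class M g \<longleftrightarrow> (AE x in M. f x = g x)"
proof
  assume "L2_class M f = L2_class M g"
  moreover have "f \<in> L2_class M f"
    using assms by (simp add: L2_class_def)
  ultimately show "AE x in M. f x = g x"
    by (simp add: L2_class_def)
next
  assume fg: "AE x in M. f x = g x"
  have "(AE x in M. h x = f x) \<longleftrightarrow> (AE x in M. h x = g x)" for h
  proof
    assume "AE x in M. h x = f x"
    then show "AE x in M. h x = g x" using fg by eventually_elim simp
  next
    assume "AE x in M. h x = g x"
    then show "AE x in M. h x = f x" using fg by eventually_elim simp
  qed
  then show "L2_class M f = L2_class M g"
    by (simp add: L2_class_def)
qed

lemma rep_L2_class:
  assumes "square_integrable M f"
  shows "square_integrable M (rep (L2_class M f))"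
    and "AE x in M. rep (L2_class M f) x = f x"
proof -
  have "f \<in> L2_class M f"
    using assms by (simp add: L2_class_def)
  then have "rep (L2_class M f) \<in> L2_class M f"
    unfolding rep_def by (rule someI[where P = "\<lambda>g. g \<in> L2_class M f"])
  then show "square_integrable M (rep (L2_class M f))"
    and "AE x in M. rep (L2_class M f) x = f x"
    by (auto simp: L2_class_def)
qed

lemma square_integrable_add:
  assumes "square_integrable M f" "square_integrable M g"
  shows "square_integrable M (\<lambda>x. f x + g x)"
proof -
  have [measurable]: "f \<in> borel_measurable M" "g \<in> borel_measurable M"
    using assms by (auto simp: square_integrable_def)
  have "integrable M (\<lambda>x. (cmod (f x + g x))\<^sup>2)"
  proof (rule Bochner_Integration.integrable_bound)
    show "integrable M (\<lambda>x. 2 * (cmod (f x))\<^sup>2 + 2 * (cmod (g x))\<^sup>2)"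
      using assms by (auto simp: square_integrable_def)
    have "(cmod (f x + g x))\<^sup>2 \<le> 2 * (cmod (f x))\<^sup>2 + 2 * (cmod (g x))\<^sup>2" for x
    proof -
      have "(cmod (f x + g x))\<^sup>2 \<le> (cmod (f x) + cmod (g x))\<^sup>2"
        by (intro power_mono norm_triangle_ineq) simp
      also have "\<dots> \<le> 2 * (cmod (f x))\<^sup>2 + 2 * (cmod (g x))\<^sup>2"
        using sum_squares_bound[of "cmod (f x)" "cmod (g x)"] by (simp add: power2_sum)
      finally show ?thesis .
    qed
    then show "AE x in M. norm ((cmod (f x + g x))\<^sup>2)
        \<le> norm (2 * (cmod (f x))\<^sup>2 + 2 * (cmod (g x))\<^sup>2)"
      by simp
  qed measurable
  then show ?thesis
    by (simp add: square_integrable_def)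
qed

lemma square_integrable_scale:
  assumes "square_integrable M f"
  shows "square_integrable M (\<lambda>x. c * f x)"
  using assms by (auto simp: square_integrable_def norm_mult power_mult_distrib)

lemma L2_space_add:
  assumes "square_integrable M f" "square_integrable M g"
  shows "vadd (L2_space M) (L2_class M f) (L2_class M g) = L2_class M (\<lambda>x. f x + g x)"
proof -
  have "AE x in M. rep (L2_class M f) x + rep (L2_class M g) x = f x + g x"
    using rep_L2_class(2)[OF assms(1)] rep_L2_class(2)[OF assms(2)] by eventually_elim simp
  then show ?thesis
    by (simp add: L2_space_def L2_class_eq_iff square_integrable_add rep_L2_class(1) assms)
qed

lemma L2_space_scale:
  assumes "square_integrable M f"
  shows "vscale (L2_space M) c (L2_class M f) = L2_class M (\<lambda>x. c * f x)"
proof -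
  have "AE x in M. c * rep (L2_class M f) x = c * f x"
    using rep_L2_class(2)[OF assms] by eventually_elim simp
  then show ?thesis
    by (simp add: L2_space_def L2_class_eq_iff square_integrable_scale rep_L2_class(1) assms
        del: mult_cancel_left)
qed

lemma L2_space_norm:
  assumes "square_integrable M f"
  shows "vnorm (L2_space M) (L2_class M f) = sqrt (LINT x|M. (cmod (f x))\<^sup>2)"
proof -
  have [measurable]: "f \<in> borel_measurable M" "rep (L2_class M f) \<in> borel_measurable M"
    using assms rep_L2_class(1)[OF assms] by (auto simp: square_integrable_def)
  have "AE x in M. (cmod (rep (L2_class M f) x))\<^sup>2 = (cmod (f x))\<^sup>2"
    using rep_L2_class(2)[OF assms] by eventually_elim simp
  then have "(LINT x|M. (cmod (rep (L2_class M f) x))\<^sup>2) = (LINT x|M. (cmod (f x))\<^sup>2)"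
    by (intro integral_cong_AE) measurable
  then show ?thesis
    by (simp add: L2_space_def)
qed

lemma square_integrable_powi:
  assumes "finite_measure M" "sets M = sets (restrict_space borel (sphere 0 1))"
  shows "square_integrable M (\<lambda>z. z powi m)"
proof -
  interpret finite_measure M by fact
  have sp: "space M = sphere 0 1"
    using sets_eq_imp_space_eq[OF assms(2)] by (simp add: space_restrict_space)
  have "continuous_on (sphere 0 1 :: complex set) (\<lambda>z. z powi m)"
    by (intro continuous_intros) auto
  then have meas: "(\<lambda>z. z powi m) \<in> borel_measurable M"
    using borel_measurable_continuous_on_restrict measurable_cong_sets[OF assms(2) refl]
    by blast
  have "integrable M (\<lambda>z. (cmod (z powi m))\<^sup>2) \<longleftrightarrow> integrable M (\<lambda>z. 1 :: real)"
    by (rule Bochner_Integration.integrable_cong) (auto simp: sp norm_power_int)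
  with meas show ?thesis
    by (simp add: square_integrable_def)
qed

end

theory Submission
  imports Defs "HOL-Complex_Analysis.Great_Picard"
begin

text \<open>
  The powers fail to be a basis because zero has an expansion with a nonzero coefficient.

  A discrete measure \<open>\<nu>\<close> makes the powers recurrent. On a countable set of atoms a diagonal
  argument gives exponents \<open>r k\<close> along which \<open>z ^ r k\<close> converges at every atom. The quotients
  \<open>z ^ (r (2 * k) - r k)\<close> then tend to 1 at every atom, and by dominated convergence in
  \<open>L\<^sup>2(\<nu>)\<close>, while their exponents tend to infinity
  (\<open>unimodular_powers_return\<close>, \<open>discrete_measure_powers_return\<close>). Hence every power \<open>z powi i\<close> is
  an \<open>L\<^sup>2\<close>-limit of powers with exponents different from all those that occur early in the given
  enumeration: each term of the sequence \<open>f\<close> is approximated by terms of arbitrarily large index.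

  Any such sequence, in any \<open>L\<^sup>2\<close> space, admits a nontrivial series with sum zero
  (\<open>nontrivial_null_series\<close>). One starts with \<open>f 1\<close> and cancels it in stages, each time using only
  terms of larger index than before. Replacing every term of the current partial sum \<open>u\<close> by a
  later neighbour gives a later combination close to \<open>u\<close>, but subtracting it might pass through
  large partial sums. This is avoided by subtracting many approximate copies of \<open>u / L\<close> one after
  another: the new partial sums stay near the multiples \<open>(1 - j / L) u\<close> with an excursion of order
  \<open>1 / L\<close> (\<open>late_approx_lin_comb\<close>). So during a stage all partial sums are bounded by about twice
  the norm at its start, and the norm at its end is as small as desired. The partial sums of the
  whole series therefore tend to zero, although the first coefficient is 1. Since the zero
  coefficients also give zero, uniqueness fails.
\<close>

section \<open>The \<open>L\<^sup>2\<close> seminorm on functions\<close>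

definition L2_seminorm :: "'a measure \<Rightarrow> ('a \<Rightarrow> complex) \<Rightarrow> real" where
  "L2_seminorm M g = sqrt (LINT x|M. (cmod (g x))\<^sup>2)"

lemma L2_seminorm_nonneg: "0 \<le> L2_seminorm M g"
  by (simp add: L2_seminorm_def)

lemma L2_seminorm_scale: "L2_seminorm M (\<lambda>x. c * g x) = cmod c * L2_seminorm M g"
  by (simp add: L2_seminorm_def norm_mult power_mult_distrib real_sqrt_mult)

lemma L2_seminorm_minus_commute:
  "L2_seminorm M (\<lambda>x. g x - h x) = L2_seminorm M (\<lambda>x. h x - g x)"
  by (simp add: L2_seminorm_def norm_minus_commute)

lemma square_integrable_minus:
  assumes "square_integrable M g" "square_integrable M h"
  shows "square_integrable M (\<lambda>x. g x - h x)"
  using square_integrable_add[OF assms(1) square_integrable_scale[OF assms(2), of "-1"]] by simp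

lemma square_integrable_sum:
  assumes "\<And>i. i \<in> I \<Longrightarrow> square_integrable M (g i)"
  shows "square_integrable M (\<lambda>x. \<Sum>i\<in>I. g i x)"
  using assms
proof (induction I rule: infinite_finite_induct)
  case (insert i I)
  then show ?case using square_integrable_add[of M "g i" "\<lambda>x. \<Sum>i\<in>I. g i x"] by simp
qed (simp_all add: square_integrable_def)

text \<open>
  A family of quadratic bounds indexed by \<open>t\<close>; optimising over \<open>t\<close> after integration yields the
  triangle inequality for the \<open>L\<^sup>2\<close> seminorm.
\<close>

lemma cmod_add_squared_le:
  assumes "0 < t"
  shows "(cmod (u + v))\<^sup>2 \<le> (1 + t) * (cmod u)\<^sup>2 + (1 + 1 / t) * (cmod v)\<^sup>2"
proof -
  have "(cmod (u + v))\<^sup>2 \<le> (cmod u + cmod v)\<^sup>2"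
    by (intro power_mono norm_triangle_ineq) simp
  also have "\<dots> = (1 + t) * (cmod u)\<^sup>2 + (1 + 1 / t) * (cmod v)\<^sup>2 - (t * cmod u - cmod v)\<^sup>2 / t"
    using assms by (simp add: field_simps power2_eq_square)
  also have "\<dots> \<le> (1 + t) * (cmod u)\<^sup>2 + (1 + 1 / t) * (cmod v)\<^sup>2"
    using assms by simp
  finally show ?thesis .
qed

lemma L2_seminorm_triangle:
  assumes g: "square_integrable M g" and h: "square_integrable M h"
  shows "L2_seminorm M (\<lambda>x. g x + h x) \<le> L2_seminorm M g + L2_seminorm M h"
proof (rule field_le_epsilon)
  fix e :: real assume "0 < e"
  let ?a = "L2_seminorm M g + e / 2" and ?b = "L2_seminorm M h + e / 2"
  have pos: "0 < ?a" "0 < ?b"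
    using L2_seminorm_nonneg[of M g] L2_seminorm_nonneg[of M h] \<open>0 < e\<close> by auto
  \<comment> \<open>The optimal weight; adding \<open>e / 2\<close> to both seminorms keeps it finite and positive.\<close>
  define t where "t = ?b / ?a"
  have t: "0 < t" using pos by (simp add: t_def)
  have ig: "integrable M (\<lambda>x. (cmod (g x))\<^sup>2)" and ih: "integrable M (\<lambda>x. (cmod (h x))\<^sup>2)"
    using g h by (auto simp: square_integrable_def)
  have ge: "(LINT x|M. (cmod (g x))\<^sup>2) \<le> ?a\<^sup>2" and he: "(LINT x|M. (cmod (h x))\<^sup>2) \<le> ?b\<^sup>2"
    using \<open>0 < e\<close> by (auto simp: L2_seminorm_def intro!: sqrt_le_D)
  have "(LINT x|M. (cmod (g x + h x))\<^sup>2)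
      \<le> (LINT x|M. (1 + t) * (cmod (g x))\<^sup>2 + (1 + 1 / t) * (cmod (h x))\<^sup>2)"
    using square_integrable_add[OF g h] ig ih cmod_add_squared_le[OF t]
    by (intro integral_mono) (auto simp: square_integrable_def)
  also have "\<dots> = (1 + t) * (LINT x|M. (cmod (g x))\<^sup>2) + (1 + 1 / t) * (LINT x|M. (cmod (h x))\<^sup>2)"
    using ig ih by simp
  also have "\<dots> \<le> (1 + t) * ?a\<^sup>2 + (1 + 1 / t) * ?b\<^sup>2"
    using ge he t by (intro add_mono mult_left_mono) auto
  also have "\<dots> = (?a + ?b)\<^sup>2"
  proof -
    have "(1 + b / a) * a\<^sup>2 + (1 + 1 / (b / a)) * b\<^sup>2 = (a + b)\<^sup>2" if "0 < a" "0 < b" for a b :: real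
      using that by (simp add: field_simps power2_eq_square)
    then show ?thesis unfolding t_def using pos by blast
  qed
  finally have "L2_seminorm M (\<lambda>x. g x + h x) \<le> ?a + ?b"
    unfolding L2_seminorm_def[of M "\<lambda>x. g x + h x"] using pos by (intro real_le_lsqrt) auto
  then show "L2_seminorm M (\<lambda>x. g x + h x) \<le> L2_seminorm M g + L2_seminorm M h + e"
    by simp
qed

lemma L2_seminorm_triangle_minus:
  assumes "square_integrable M g" "square_integrable M h"
  shows "L2_seminorm M (\<lambda>x. g x - h x) \<le> L2_seminorm M g + L2_seminorm M h"
  using L2_seminorm_triangle[OF assms(1) square_integrable_scale[OF assms(2), of "-1"]]
    L2_seminorm_scale[of M "-1" h] by simp

section \<open>Sequences that accumulate at each of their terms\<close>

definition lin_comb :: "(nat \<Rightarrow> 'a \<Rightarrow> complex) \<Rightarrow> (nat \<Rightarrow> complex) \<Rightarrow> nat \<Rightarrow> 'a \<Rightarrow> complex" where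
  "lin_comb f a k x = (\<Sum>n=1..k. a n * f n x)"

lemma lin_comb_add: "lin_comb f (\<lambda>n. a n + b n) k x = lin_comb f a k x + lin_comb f b k x"
  by (simp add: lin_comb_def sum.distrib algebra_simps)

lemma lin_comb_minus: "lin_comb f (\<lambda>n. a n - b n) k x = lin_comb f a k x - lin_comb f b k x"
  by (simp add: lin_comb_def sum_subtractf algebra_simps)

lemma lin_comb_cong:
  assumes "\<And>n. 1 \<le> n \<Longrightarrow> n \<le> k \<Longrightarrow> a n = b n"
  shows "lin_comb f a k = lin_comb f b k"
  using assms by (auto simp: lin_comb_def intro!: sum.cong)

lemma lin_comb_eq_zero:
  assumes "\<And>n. n \<le> k \<Longrightarrow> a n = 0"
  shows "lin_comb f a k = (\<lambda>x. 0)"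
  using assms by (auto simp: lin_comb_def intro!: sum.neutral)

lemma lin_comb_eq_last:
  assumes "N \<le> k" "\<And>n. N < n \<Longrightarrow> a n = 0"
  shows "lin_comb f a k = lin_comb f a N"
  using assms unfolding lin_comb_def by (intro ext sum.mono_neutral_right) auto

text \<open>
  Every term of the sequence can be approximated, arbitrarily well, by terms of arbitrarily large
  index.
\<close>

locale recurrent_sequence =
  fixes M :: "'a measure" and f :: "nat \<Rightarrow> 'a \<Rightarrow> complex"
  assumes square_integrable_term: "square_integrable M (f n)"
    and recurrent: "0 < e \<Longrightarrow> \<exists>m>N. L2_seminorm M (\<lambda>x. f m x - f n x) < e"
begin

lemma square_integrable_lin_comb: "square_integrable M (lin_comb f a k)"
  unfolding lin_comb_def[abs_def]
  by (intro square_integrable_sum square_integrable_scale square_integrable_term)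

text \<open>
  Far out in the sequence there are linear combinations close to \<open>u\<close> that are built up without
  ever exceeding the norm \<open>C\<close> by much. The control of all partial sums, not only of the last one,
  is what allows such combinations to be concatenated into a convergent series.
\<close>

definition late_approx :: "('a \<Rightarrow> complex) \<Rightarrow> real \<Rightarrow> bool" where
  "late_approx u C \<longleftrightarrow> square_integrable M u \<and> (\<forall>N. \<forall>e>0. \<exists>d N'. N < N' \<and>
     (\<forall>n\<le>N. d n = 0) \<and> (\<forall>n>N'. d n = 0) \<and>
     (\<forall>k. L2_seminorm M (lin_comb f d k) \<le> C + e) \<and>
     L2_seminorm M (\<lambda>x. lin_comb f d N' x - u x) < e)"

lemma late_approx_limit_bound:
  assumes "\<And>e. 0 < e \<Longrightarrow> late_approx u (C + e)"
  shows "late_approx u C"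
  unfolding late_approx_def
proof (intro conjI allI impI)
  show "square_integrable M u"
    using assms[of 1] by (simp add: late_approx_def)
  fix N and e :: real assume e: "0 < e"
  then have late: "late_approx u (C + e / 2)" and e2: "0 < e / 2" using assms by auto
  obtain d N' where d: "N < N'" "\<And>n. n \<le> N \<Longrightarrow> d n = 0" "\<And>n. N' < n \<Longrightarrow> d n = 0"
    "\<And>k. L2_seminorm M (lin_comb f d k) \<le> C + e / 2 + e / 2"
    "L2_seminorm M (\<lambda>x. lin_comb f d N' x - u x) < e / 2"
    using late e2 unfolding late_approx_def by blast
  show "\<exists>d N'. N < N' \<and> (\<forall>n\<le>N. d n = 0) \<and> (\<forall>n>N'. d n = 0) \<and>
     (\<forall>k. L2_seminorm M (lin_comb f d k) \<le> C + e) \<and>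
     L2_seminorm M (\<lambda>x. lin_comb f d N' x - u x) < e"
  proof (intro exI[of _ d] exI[of _ N'] conjI allI impI)
    show "L2_seminorm M (lin_comb f d k) \<le> C + e" for k using d(4)[of k] by simp
    show "L2_seminorm M (\<lambda>x. lin_comb f d N' x - u x) < e" using d(5) e by simp
  qed (use d in \<open>auto simp: not_less[symmetric]\<close>)
qed

lemma late_approx_zero: "late_approx (\<lambda>x. 0) 0"
  unfolding late_approx_def
proof (intro conjI allI impI)
  show "square_integrable M (\<lambda>x. 0)" by (simp add: square_integrable_def)
  fix N and e :: real assume "0 < e"
  then show "\<exists>d N'. N < N' \<and> (\<forall>n\<le>N. d n = 0) \<and> (\<forall>n>N'. d n = 0) \<and>
     (\<forall>k. L2_seminorm M (lin_comb f d k) \<le> 0 + e) \<and>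
     L2_seminorm M (\<lambda>x. lin_comb f d N' x - 0) < e"
    by (intro exI[of _ "\<lambda>n. 0"] exI[of _ "Suc N"])
       (auto simp: lin_comb_eq_zero L2_seminorm_def lin_comb_def)
qed

lemma late_approx_term: "late_approx (\<lambda>x. c * f n x) (cmod c * L2_seminorm M (f n))"
  unfolding late_approx_def
proof (intro conjI allI impI)
  show "square_integrable M (\<lambda>x. c * f n x)"
    by (intro square_integrable_scale square_integrable_term)
  fix N and e :: real assume e: "0 < e"
  define e' where "e' = e / (cmod c + 1)"
  have c1: "0 < cmod c + 1" using norm_ge_zero[of c] by linarith
  then have e': "0 < e'" "cmod c * e' < e"
    using e by (simp_all add: e'_def field_simps)
  obtain m where m: "N < m" "L2_seminorm M (\<lambda>x. f m x - f n x) < e'"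
    using recurrent[OF e'(1)] by blast
  define d where "d i = (if i = m then c else 0)" for i
  have comb: "lin_comb f d k = (if m \<le> k then \<lambda>x. c * f m x else (\<lambda>x. 0))" for k
    using m(1) by (auto simp: lin_comb_def d_def fun_eq_iff if_distrib[of "\<lambda>c. c * _"] cong: if_cong)
  have le: "cmod c * L2_seminorm M (\<lambda>x. f m x - f n x) \<le> cmod c * e'"
    using m(2) by (intro mult_left_mono) auto
  have "L2_seminorm M (f m) \<le> L2_seminorm M (\<lambda>x. f m x - f n x) + L2_seminorm M (f n)"
    using L2_seminorm_triangle[OF square_integrable_minus[OF square_integrable_term square_integrable_term]
        square_integrable_term, of m n n] by simp
  then have "cmod c * L2_seminorm M (f m)
      \<le> cmod c * (L2_seminorm M (\<lambda>x. f m x - f n x) + L2_seminorm M (f n))"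
    by (intro mult_left_mono) auto
  then have bd: "cmod c * L2_seminorm M (f m) \<le> cmod c * L2_seminorm M (f n) + e"
    using le e'(2) by (simp add: distrib_left)
  show "\<exists>d N'. N < N' \<and> (\<forall>n\<le>N. d n = 0) \<and> (\<forall>n>N'. d n = 0) \<and>
     (\<forall>k. L2_seminorm M (lin_comb f d k) \<le> cmod c * L2_seminorm M (f n) + e) \<and>
     L2_seminorm M (\<lambda>x. lin_comb f d N' x - c * f n x) < e"
  proof (intro exI[of _ d] exI[of _ m] conjI allI impI)
    show "L2_seminorm M (lin_comb f d k) \<le> cmod c * L2_seminorm M (f n) + e" for k
      using bd e L2_seminorm_nonneg[of M "f n"]
      by (auto simp: comb L2_seminorm_scale) (simp add: L2_seminorm_def)
    have "L2_seminorm M (\<lambda>x. lin_comb f d m x - c * f n x) = cmod c * L2_seminorm M (\<lambda>x. f m x - f n x)"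
      unfolding L2_seminorm_scale[symmetric] by (simp add: comb algebra_simps)
    then show "L2_seminorm M (\<lambda>x. lin_comb f d m x - c * f n x) < e"
      using le e'(2) by simp
  qed (use m in \<open>auto simp: d_def split: if_splits\<close>)
qed

text \<open>
  First a late approximation of \<open>u\<close> is built, then one of \<open>v\<close> beyond it. While the second one is
  under construction the first is finished and has norm about \<open>L2_seminorm M u\<close>, so the bound
  needed is the maximum of \<open>C\<close> and \<open>L2_seminorm M u + D\<close>, not the cruder \<open>C + D\<close>. The
  splitting into small copies in \<open>late_approx_lin_comb\<close> depends on this.
\<close>

lemma late_approx_add:
  assumes u: "late_approx u C" and v: "late_approx v D"
    and B: "C \<le> B" "L2_seminorm M u + D \<le> B"
  shows "late_approx (\<lambda>x. u x + v x) B"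
  unfolding late_approx_def
proof (intro conjI allI impI)
  have si: "square_integrable M u" "square_integrable M v"
    using u v by (auto simp: late_approx_def)
  then show "square_integrable M (\<lambda>x. u x + v x)"
    by (rule square_integrable_add)
  fix N and e :: real assume e: "0 < e"
  then have e2: "0 < e / 2" by simp
  obtain d N1 where d: "N < N1" "\<And>n. n \<le> N \<Longrightarrow> d n = 0" "\<And>n. N1 < n \<Longrightarrow> d n = 0"
    "\<And>k. L2_seminorm M (lin_comb f d k) \<le> C + e / 2"
    "L2_seminorm M (\<lambda>x. lin_comb f d N1 x - u x) < e / 2"
    using u e2 unfolding late_approx_def by blast
  obtain d' N2 where d': "N1 < N2" "\<And>n. n \<le> N1 \<Longrightarrow> d' n = 0" "\<And>n. N2 < n \<Longrightarrow> d' n = 0"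
    "\<And>k. L2_seminorm M (lin_comb f d' k) \<le> D + e / 2"
    "L2_seminorm M (\<lambda>x. lin_comb f d' N2 x - v x) < e / 2"
    using v e2 unfolding late_approx_def by blast
  define b where "b n = d n + d' n" for n
  have comb: "lin_comb f b k x = lin_comb f d k x + lin_comb f d' k x" for k x
    unfolding b_def by (rule lin_comb_add)
  have late: "lin_comb f d k = lin_comb f d N1" if "N1 \<le> k" for k
    using that d(3) by (rule lin_comb_eq_last)
  show "\<exists>d N'. N < N' \<and> (\<forall>n\<le>N. d n = 0) \<and> (\<forall>n>N'. d n = 0) \<and>
     (\<forall>k. L2_seminorm M (lin_comb f d k) \<le> B + e) \<and>
     L2_seminorm M (\<lambda>x. lin_comb f d N' x - (u x + v x)) < e"
  proof (intro exI[of _ b] exI[of _ N2] conjI allI impI)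
    show "L2_seminorm M (lin_comb f b k) \<le> B + e" for k
    proof (cases "N1 \<le> k")
      case False
      then have "lin_comb f b k = lin_comb f d k"
        using d'(2) by (intro lin_comb_cong) (auto simp: b_def)
      then show ?thesis using d(4)[of k] B(1) e by simp
    next
      case True
      have split: "lin_comb f b k = (\<lambda>x. ((lin_comb f d N1 x - u x) + u x) + lin_comb f d' k x)"
        by (simp add: comb late[OF True] fun_eq_iff)
      have "L2_seminorm M (lin_comb f b k) \<le> L2_seminorm M (\<lambda>x. (lin_comb f d N1 x - u x) + u x)
          + L2_seminorm M (lin_comb f d' k)"
        unfolding split by (intro L2_seminorm_triangle square_integrable_add square_integrable_minus
            square_integrable_lin_comb si)
      moreover have "L2_seminorm M (\<lambda>x. (lin_comb f d N1 x - u x) + u x)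
          \<le> L2_seminorm M (\<lambda>x. lin_comb f d N1 x - u x) + L2_seminorm M u"
        by (intro L2_seminorm_triangle square_integrable_minus square_integrable_lin_comb si)
      ultimately show ?thesis using d(5) d'(4)[of k] B(2) by simp
    qed
    have split: "(\<lambda>x. lin_comb f b N2 x - (u x + v x))
        = (\<lambda>x. (lin_comb f d N1 x - u x) + (lin_comb f d' N2 x - v x))"
      using late[of N2] d'(1) by (simp add: comb fun_eq_iff)
    have "L2_seminorm M (\<lambda>x. lin_comb f b N2 x - (u x + v x))
        \<le> L2_seminorm M (\<lambda>x. lin_comb f d N1 x - u x) + L2_seminorm M (\<lambda>x. lin_comb f d' N2 x - v x)"
      unfolding split by (intro L2_seminorm_triangle square_integrable_minus square_integrable_lin_comb si)
    then show "L2_seminorm M (\<lambda>x. lin_comb f b N2 x - (u x + v x)) < e"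
      using d(5) d'(5) by simp
    show "N < N2" using d(1) d'(1) by simp
    show "b n = 0" if "n \<le> N" for n
      using that d(1,2) d'(2) by (simp add: b_def)
    show "b n = 0" if "N2 < n" for n
      using that d(3) d'(1,3) by (simp add: b_def)
  qed
qed

text \<open>
  Replacing the terms one at a time by later neighbours gives a bound by the sum of the norms,
  which can be much larger than the norm of the combination. It serves as a first bound, to be
  improved below.
\<close>

lemma late_approx_lin_comb_weak:
  "late_approx (lin_comb f a k) (\<Sum>n=1..k. cmod (a n) * L2_seminorm M (f n))"
proof (induction k)
  case 0
  then show ?case using late_approx_zero by (simp add: lin_comb_eq_zero lin_comb_def[abs_def])
next
  case (Suc k)
  let ?C = "\<lambda>k. \<Sum>n=1..k. cmod (a n) * L2_seminorm M (f n)"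
  have bd: "L2_seminorm M (lin_comb f a k) \<le> ?C k"
  proof (induction k)
    case 0
    then show ?case by (simp add: lin_comb_def[abs_def] L2_seminorm_def)
  next
    case (Suc k)
    have "L2_seminorm M (\<lambda>x. lin_comb f a k x + a (Suc k) * f (Suc k) x)
      \<le> L2_seminorm M (lin_comb f a k) + L2_seminorm M (\<lambda>x. a (Suc k) * f (Suc k) x)"
      by (intro L2_seminorm_triangle square_integrable_lin_comb square_integrable_scale
          square_integrable_term)
    then show ?case using Suc by (simp add: L2_seminorm_scale lin_comb_def[abs_def])
  qed
  have "late_approx (\<lambda>x. lin_comb f a k x + a (Suc k) * f (Suc k) x) (?C (Suc k))"
    using bd L2_seminorm_nonneg[of M "f (Suc k)"]
    by (intro late_approx_add[OF Suc late_approx_term]) auto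
  then show ?case by (simp add: lin_comb_def[abs_def])
qed

text \<open>
  The bound improves to the norm of the combination \<open>u\<close> itself: if the weak bound for \<open>u\<close> is \<open>C\<close>,
  then it is \<open>C / L\<close> for \<open>u / L\<close>, and after \<open>j\<close> of \<open>L\<close> successive approximate copies of \<open>u / L\<close>
  the partial sum is close to \<open>j u / L\<close>. All partial sums thus stay below \<open>\<parallel>u\<parallel> + C / L\<close> up to
  arbitrarily small errors.
\<close>

lemma late_approx_lin_comb: "late_approx (lin_comb f a k) (L2_seminorm M (lin_comb f a k))"
proof (rule late_approx_limit_bound)
  fix e :: real assume e: "0 < e"
  let ?u = "lin_comb f a k"
  define C where "C = (\<Sum>n=1..k. cmod (a n) * L2_seminorm M (f n))"
  obtain L :: nat where L: "C / e < real L" "0 < L"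
    using reals_Archimedean2[of "max (C / e) 0"] by auto
  define t where "t = 1 / real L"
  have t: "0 < t" "t * C < e" "real L * t = 1"
    using L e by (simp_all add: t_def field_simps)
  have small: "late_approx (\<lambda>x. t * ?u x) (t * C)"
  proof -
    have "late_approx (lin_comb f (\<lambda>n. t * a n) k)
        (\<Sum>n=1..k. cmod (t * a n) * L2_seminorm M (f n))"
      by (rule late_approx_lin_comb_weak)
    also have "lin_comb f (\<lambda>n. t * a n) k = (\<lambda>x. t * ?u x)"
      by (simp add: lin_comb_def fun_eq_iff sum_distrib_left mult.assoc)
    also have "(\<Sum>n=1..k. cmod (t * a n) * L2_seminorm M (f n)) = t * C"
      using t(1) by (simp add: C_def sum_distrib_left norm_mult mult.assoc)
    finally show ?thesis .
  qed
  have C: "0 \<le> t * C"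
    using t(1) by (auto simp: C_def intro!: mult_nonneg_nonneg sum_nonneg L2_seminorm_nonneg)
  have "late_approx (\<lambda>x. of_real (real j * t) * ?u x) (real j * t * L2_seminorm M ?u + t * C)" for j
  proof (induction j)
    case 0
    have "late_approx (\<lambda>x. 0) (0 + t * C)"
      using late_approx_add[OF late_approx_zero late_approx_zero, of "t * C"] C
      by (simp add: L2_seminorm_def)
    then show ?case by simp
  next
    case (Suc j)
    have "late_approx (\<lambda>x. of_real (real j * t) * ?u x + of_real t * ?u x)
        (real (Suc j) * t * L2_seminorm M ?u + t * C)"
      using t(1) L2_seminorm_nonneg[of M ?u] 
      by (intro late_approx_add[OF Suc small])
         (auto simp: L2_seminorm_scale norm_mult algebra_simps)
    then show ?case by (simp add: algebra_simps)
  qed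
  from this[of L] have "late_approx ?u (L2_seminorm M ?u + t * C)" by (simp only: t(3)) simp
  \<comment> \<open>Adding zero weakens the bound from \<open>t * C\<close> to \<open>e\<close>.\<close>
  from late_approx_add[OF this late_approx_zero, of "L2_seminorm M ?u + e"] t(2) e
  show "late_approx ?u (L2_seminorm M ?u + e)" by simp
qed

text \<open>
  One stage of the construction: a finite combination is extended by later terms so as to become
  small, subtracting a late approximation of itself. The factor 2 comes from the triangle
  inequality, since the partial sums of the approximation are bounded by the norm of what is
  approximated.
\<close>

lemma null_series_step:
  assumes supp: "\<And>n. N < n \<Longrightarrow> a n = 0" and e: "0 < e"
  shows "\<exists>a' N'. N < N' \<and> (\<forall>n\<le>N. a' n = a n) \<and> (\<forall>n>N'. a' n = 0) \<and>
    (\<forall>k\<ge>N. L2_seminorm M (lin_comb f a' k) \<le> 2 * L2_seminorm M (lin_comb f a N) + e) \<and>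
    L2_seminorm M (lin_comb f a' N') < e"
proof -
  obtain d N' where d: "N < N'" "\<And>n. n \<le> N \<Longrightarrow> d n = 0" "\<And>n. N' < n \<Longrightarrow> d n = 0"
    "\<And>k. L2_seminorm M (lin_comb f d k) \<le> L2_seminorm M (lin_comb f a N) + e"
    "L2_seminorm M (\<lambda>x. lin_comb f d N' x - lin_comb f a N x) < e"
    using late_approx_lin_comb[of a N] e unfolding late_approx_def by blast
  define a' where "a' n = a n - d n" for n
  have comb: "lin_comb f a' k = (\<lambda>x. lin_comb f a N x - lin_comb f d k x)" if "N \<le> k" for k
    by (simp add: a'_def[abs_def] lin_comb_minus fun_eq_iff lin_comb_eq_last[OF that supp])
  show ?thesis
  proof (intro exI[of _ a'] exI[of _ N'] conjI allI impI)
    show "L2_seminorm M (lin_comb f a' k) \<le> 2 * L2_seminorm M (lin_comb f a N) + e" if "N \<le> k" for k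
      using L2_seminorm_triangle_minus[OF square_integrable_lin_comb square_integrable_lin_comb,
          of a N d k] d(4)[of k] by (simp add: comb[OF that])
    show "L2_seminorm M (lin_comb f a' N') < e"
      using d(1,5) L2_seminorm_minus_commute[of M "lin_comb f d N'" "lin_comb f a N"]
      by (simp add: comb)
  qed (use d supp in \<open>auto simp: a'_def\<close>)
qed

text \<open>
  For \<open>j \<ge> 1\<close>, stage \<open>j\<close> starts from norm at most \<open>1 / j\<close> and ends with norm at most \<open>1 / (j + 1)\<close>, so all
  partial sums within it are bounded by \<open>2 / j + 1 / (j + 1)\<close>. Later stages do not change earlier
  coefficients, so the coefficient sequences have a limit that still begins with 1.
\<close>

theorem nontrivial_null_series:
  obtains a where "a 1 = 1" "(\<lambda>k. L2_seminorm M (lin_comb f a k)) \<longlonglongrightarrow> 0"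
proof -
  define P where "P j s \<longleftrightarrow> (case s of (a :: nat \<Rightarrow> complex, N) \<Rightarrow>
      1 \<le> N \<and> a 1 = 1 \<and> (\<forall>n>N. a n = 0) \<and>
      (0 < j \<longrightarrow> L2_seminorm M (lin_comb f a N) < 1 / real j))" for j :: nat and s
  define Q where "Q j s s' \<longleftrightarrow> (case s of (a :: nat \<Rightarrow> complex, N) \<Rightarrow> case s' of (a', N') \<Rightarrow>
      N < N' \<and> (\<forall>n\<le>N. a' n = a n) \<and>
      (\<forall>k\<ge>N. L2_seminorm M (lin_comb f a' k)
          \<le> 2 * L2_seminorm M (lin_comb f a N) + 1 / real (Suc j)))" for j :: nat and s s'
  have "\<exists>s. \<forall>j. P j (s j) \<and> Q j (s j) (s (Suc j))"
  proof (rule dependent_nat_choice)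
    show "\<exists>s. P 0 s"
      by (intro exI[of _ "(\<lambda>n. if n = 1 then 1 else 0, 1)"]) (simp add: P_def)
  next
    fix s j assume "P j s"
    then obtain a N where s: "s = (a, N)" "1 \<le> N" "a 1 = 1" "\<And>n. N < n \<Longrightarrow> a n = 0"
      by (auto simp: P_def split: prod.splits)
    have e: "0 < 1 / real (Suc j)" by simp
    obtain a' N' where "N < N'" "\<And>n. n \<le> N \<Longrightarrow> a' n = a n" "\<And>n. N' < n \<Longrightarrow> a' n = 0"
      "\<And>k. N \<le> k \<Longrightarrow> L2_seminorm M (lin_comb f a' k)
          \<le> 2 * L2_seminorm M (lin_comb f a N) + 1 / real (Suc j)"
      "L2_seminorm M (lin_comb f a' N') < 1 / real (Suc j)"
      using null_series_step[of N a, OF s(4) e] by blast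
    then show "\<exists>s'. P (Suc j) s' \<and> Q j s s'"
      using s(1-3) by (intro exI[of _ "(a', N')"]) (auto simp: P_def Q_def)
  qed
  then obtain s where s: "\<And>j. P j (s j)" "\<And>j. Q j (s j) (s (Suc j))" by blast
  define b where "b j = fst (s j)" for j
  define N where "N j = snd (s j)" for j
  have b1: "b j 1 = 1" and N1: "1 \<le> N j"
    and small: "0 < j \<Longrightarrow> L2_seminorm M (lin_comb f (b j) (N j)) < 1 / real j" for j
    using s(1)[of j] by (auto simp: P_def b_def N_def split: prod.splits)
  have step: "N j < N (Suc j)" and keep: "n \<le> N j \<Longrightarrow> b (Suc j) n = b j n"
    and bound: "N j \<le> k \<Longrightarrow> L2_seminorm M (lin_comb f (b (Suc j)) k)
          \<le> 2 * L2_seminorm M (lin_comb f (b j) (N j)) + 1 / real (Suc j)" for j n k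
    using s(2)[of j] by (auto simp: Q_def b_def N_def split: prod.splits)
  have N: "strict_mono N" using step by (simp add: strict_mono_Suc_iff)
  have stable: "b i n = b j n" if "n \<le> N j" "j \<le> i" for i j n
    using that(2)
  proof (induction i rule: dec_induct)
    case (step i)
    have "n \<le> N i" using that(1) step(1) N by (meson order.trans strict_mono_less_eq)
    then show ?case using keep step.IH by simp
  qed simp
  have Nid: "n \<le> N n" for n using N by (rule strict_mono_imp_increasing)
  \<comment> \<open>Since \<open>n \<le> N n\<close>, the coefficient with index \<open>n\<close> is final from stage \<open>n\<close> on.\<close>
  define a where "a n = b n n" for n
  have a: "a n = b j n" if "n \<le> N j" for n j
    unfolding a_def using stable[of n j n] stable[of n n j] that Nid[of n] by (cases "j \<le> n") auto
  show thesis
  proof (rule that[of a])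
    show "a 1 = 1" using b1 by (simp add: a_def)
    show "(\<lambda>k. L2_seminorm M (lin_comb f a k)) \<longlonglongrightarrow> 0"
    proof (rule LIMSEQ_I)
      fix r :: real assume r: "0 < r"
      obtain J :: nat where J: "0 < J" "3 / r < real J"
        using reals_Archimedean2[of "max (3 / r) 0"] by auto
      have "norm (L2_seminorm M (lin_comb f a k) - 0) < r" if k: "N J \<le> k" for k
      proof -
        \<comment> \<open>The stage to which the index \<open>k\<close> belongs.\<close>
        define j where "j = (LEAST j. k < N (Suc j))"
        have ex: "k < N (Suc k)" using Nid[of "Suc k"] by simp
        have j1: "k < N (Suc j)" unfolding j_def using ex by (rule LeastI)
        have "N J < N (Suc j)" using k j1 by simp
        then have "J \<le> j" using strict_mono_less[OF N] by simp
        have j2: "N j \<le> k"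
        proof (cases "j = J")
          case False
          then obtain i where i: "j = Suc i" using \<open>J \<le> j\<close> by (cases j) auto
          then have "\<not> k < N (Suc i)" unfolding j_def by (intro not_less_Least) simp
          then show ?thesis using i by simp
        qed (use k in simp)
        have "lin_comb f a k = lin_comb f (b (Suc j)) k"
          using j1 by (intro lin_comb_cong a) simp
        then have "L2_seminorm M (lin_comb f a k)
            \<le> 2 * L2_seminorm M (lin_comb f (b j) (N j)) + 1 / real (Suc j)"
          using bound[OF j2] by simp
        also have "\<dots> < 2 * (1 / real j) + 1 / real j"
          using small[of j] \<open>J \<le> j\<close> J(1) by (intro add_less_le_mono) (auto simp: frac_le)
        also have "\<dots> \<le> 3 / real J"
          using \<open>J \<le> j\<close> J(1) by (simp add: frac_le)
        also have "\<dots> < r" using J r by (simp add: field_simps)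
        finally show ?thesis using L2_seminorm_nonneg[of M "lin_comb f a k"] by simp
      qed
      then show "\<exists>no. \<forall>k\<ge>no. norm (L2_seminorm M (lin_comb f a k) - 0) < r" by blast
    qed
  qed
qed

end

section \<open>Recurrence of the powers for a discrete measure\<close>

text \<open>
  The limits along a common subsequence \<open>r\<close> are unknown, but they have modulus 1, so dividing two
  terms of the subsequence produces the limit 1. The terms with indices \<open>2 * k\<close> and \<open>k\<close> are used
  because strict monotonicity of \<open>r\<close> then forces the exponent \<open>r (2 * k) - r k\<close> to be at least \<open>k\<close>.
\<close>

lemma unimodular_powers_return:
  fixes E :: "complex set"
  assumes "countable E" "\<And>z. z \<in> E \<Longrightarrow> cmod z = 1"
  obtains m :: "nat \<Rightarrow> nat" where "\<And>k. k \<le> m k" "\<And>z. z \<in> E \<Longrightarrow> (\<lambda>k. z ^ m k) \<longlonglongrightarrow> 1"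
proof -
  have "\<exists>r. strict_mono r \<and> (\<forall>z\<in>E. \<exists>l. (\<lambda>k. z ^ r k) \<longlonglongrightarrow> l)"
  proof (rule function_convergent_subsequence[OF assms(1), of "\<lambda>n z. z ^ n" 1])
    show "norm (z ^ n) \<le> 1" if "z \<in> E" for n z using assms(2)[OF that] by (simp add: norm_power)
  qed blast
  then obtain r :: "nat \<Rightarrow> nat" where r: "strict_mono r"
    "\<And>z. z \<in> E \<Longrightarrow> \<exists>l. (\<lambda>k. z ^ r k) \<longlonglongrightarrow> l" by blast
  have gap: "r k + i \<le> r (k + i)" for k i
  proof (induction i)
    case (Suc i)
    then show ?case using strict_monoD[OF r(1), of "k + i" "Suc (k + i)"] by simp
  qed simp
  show thesis
  proof (rule that[of "\<lambda>k. r (k + k) - r k"])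
    show "k \<le> r (k + k) - r k" for k using gap[of k k] by simp
    fix z assume z: "z \<in> E"
    then have nz: "z \<noteq> 0" using assms(2) by fastforce
    obtain l where l: "(\<lambda>k. z ^ r k) \<longlonglongrightarrow> l" using r(2)[OF z] by blast
    have "(\<lambda>k. cmod (z ^ r k)) \<longlonglongrightarrow> cmod l" using l by (rule tendsto_norm)
    then have "cmod l = 1" using assms(2)[OF z] by (simp add: norm_power LIMSEQ_const_iff)
    then have "l \<noteq> 0" by auto
    have "strict_mono (\<lambda>k::nat. k + k)" by (auto simp: strict_mono_def)
    then have "(\<lambda>k. z ^ r (k + k)) \<longlonglongrightarrow> l"
      using LIMSEQ_subseq_LIMSEQ[OF l] by (simp add: comp_def)
    then have "(\<lambda>k. z ^ r (k + k) / z ^ r k) \<longlonglongrightarrow> l / l"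
      using l \<open>l \<noteq> 0\<close> by (rule tendsto_divide)
    moreover have "z ^ r (k + k) / z ^ r k = z ^ (r (k + k) - r k)" for k
      using nz gap[of k k] by (simp add: power_diff)
    ultimately show "(\<lambda>k. z ^ (r (k + k) - r k)) \<longlonglongrightarrow> 1" using \<open>l \<noteq> 0\<close> by simp
  qed
qed

text \<open>
  Discreteness is what makes pointwise convergence on a countable set sufficient; for Lebesgue
  measure distinct powers are orthogonal and cannot approach each other.
\<close>

lemma discrete_measure_powers_return:
  fixes \<nu> :: "complex measure"
  assumes sets: "sets \<nu> = sets (restrict_space borel (sphere 0 1))"
    and fin: "finite_measure \<nu>" and disc: "discrete_measure \<nu>"
  shows "\<exists>m :: nat \<Rightarrow> nat. (\<forall>k. k \<le> m k) \<and>
    (\<forall>i. (\<lambda>k. L2_seminorm \<nu> (\<lambda>z. z powi (i + int (m k)) - z powi i)) \<longlonglongrightarrow> 0)"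
proof -
  interpret finite_measure \<nu> by (rule fin)
  have sp: "space \<nu> = sphere 0 1"
    using sets_eq_imp_space_eq[OF sets] by (simp add: space_restrict_space)
  obtain E where E: "E \<in> sets \<nu>" "countable E" "emeasure \<nu> (space \<nu> - E) = 0"
    using disc by (auto simp: discrete_measure_def)
  have unit: "cmod z = 1" if "z \<in> E" for z
    using sets.sets_into_space[OF E(1)] that by (auto simp: sp)
  have AE_E: "AE z in \<nu>. z \<in> E"
    using E by (intro AE_I[of _ _ "space \<nu> - E"]) auto
  obtain m where m: "\<And>k. k \<le> m k" "\<And>z. z \<in> E \<Longrightarrow> (\<lambda>k. z ^ m k) \<longlonglongrightarrow> 1"
    using unimodular_powers_return[OF E(2) unit] by metis
  show ?thesis
  proof (intro exI[of _ m] conjI allI m(1))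
    fix i
    let ?h = "\<lambda>k z. z powi (i + int (m k)) - z powi i :: complex"
    have si: "square_integrable \<nu> (?h k)" for k
      by (intro square_integrable_minus square_integrable_powi fin sets)
    have "(\<lambda>k. LINT z|\<nu>. (cmod (?h k z))\<^sup>2) \<longlonglongrightarrow> (LINT z|\<nu>. 0)"
    proof (rule integral_dominated_convergence)
      show "(\<lambda>z. (cmod (?h k z))\<^sup>2) \<in> borel_measurable \<nu>" for k
        using si[of k] by (auto simp: square_integrable_def)
      show "integrable \<nu> (\<lambda>z. 4 :: real)" by simp
      show "AE z in \<nu>. norm ((cmod (?h k z))\<^sup>2) \<le> 4" for k
        using AE_E
      proof eventually_elim
        case (elim z)
        have "cmod (?h k z) \<le> 2"
          using norm_triangle_ineq4[of "z powi (i + int (m k))" "z powi i"] unit[OF elim]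
          by (simp add: norm_power_int)
        then have "(cmod (?h k z))\<^sup>2 \<le> 2\<^sup>2" by (intro power_mono) auto
        then show ?case by simp
      qed
      show "AE z in \<nu>. (\<lambda>k. (cmod (?h k z))\<^sup>2) \<longlonglongrightarrow> 0"
        using AE_E
      proof eventually_elim
        case (elim z)
        have "z \<noteq> 0" using unit[OF elim] by auto
        then have eq: "?h k z = z powi i * (z ^ m k - 1)" for k
          by (simp add: power_int_add algebra_simps)
        have "(\<lambda>k. (cmod (z powi i * (z ^ m k - 1)))\<^sup>2) \<longlonglongrightarrow> (cmod (z powi i * (1 - 1)))\<^sup>2"
          by (intro tendsto_intros m(2) elim)
        then show ?case by (simp add: eq)
      qed
    qed simp
    then have "(\<lambda>k. sqrt (LINT z|\<nu>. (cmod (?h k z))\<^sup>2)) \<longlonglongrightarrow> sqrt (LINT z|\<nu>. 0)"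
      by (rule tendsto_real_sqrt)
    then show "(\<lambda>k. L2_seminorm \<nu> (?h k)) \<longlonglongrightarrow> 0"
      by (simp add: L2_seminorm_def)
  qed
qed

section \<open>Failure of uniqueness\<close>

lemma partial_sum_L2_class:
  assumes "\<And>n. square_integrable M (f n)"
  shows "partial_sum (L2_space M) a (\<lambda>n. L2_class M (f n)) k = L2_class M (lin_comb f a k)"
proof (induction k)
  case 0
  then show ?case by (simp add: L2_space_def lin_comb_def[abs_def])
next
  case (Suc k)
  have "square_integrable M (lin_comb f a k)" unfolding lin_comb_def[abs_def]
    by (intro square_integrable_sum square_integrable_scale assms)
  then show ?case
    using Suc by (simp add: L2_space_scale L2_space_add square_integrable_scale assms
        lin_comb_def[abs_def])
qed

lemma vdist_zero_L2_class:
  assumes g: "square_integrable M g"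
  shows "vdist (L2_space M) (L2_class M g) (L2_class M (\<lambda>x. 0)) = L2_seminorm M g"
proof -
  have z: "square_integrable M (\<lambda>x. 0)" by (simp add: square_integrable_def)
  show ?thesis
    using L2_space_add[OF g z] L2_space_scale[OF z, of "-1"] L2_space_norm[OF g]
    by (simp add: vdist_def L2_seminorm_def)
qed

lemma (in recurrent_sequence) not_schauder_basis:
  "\<not> schauder_basis (L2_space M) (\<lambda>n. L2_class M (f n))"
proof
  assume basis: "schauder_basis (L2_space M) (\<lambda>n. L2_class M (f n))"
  let ?o = "L2_class M (\<lambda>x. 0)"
  let ?conv = "\<lambda>a. a \<in> extensional {1..} \<and>
    (\<lambda>k. vdist (L2_space M) (partial_sum (L2_space M) a (\<lambda>n. L2_class M (f n)) k) ?o) \<longlonglongrightarrow> 0"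
  have "?o \<in> points (L2_space M)"
    by (auto simp: L2_space_def square_integrable_def)
  then have uniq: "a = b" if "?conv a" "?conv b" for a b
    using basis that unfolding schauder_basis_def by blast
  have dist: "vdist (L2_space M) (partial_sum (L2_space M) a (\<lambda>n. L2_class M (f n)) k) ?o
      = L2_seminorm M (lin_comb f a k)" for a k
    by (simp add: partial_sum_L2_class square_integrable_term vdist_zero_L2_class
        square_integrable_lin_comb)
  obtain a where a: "a 1 = 1" "(\<lambda>k. L2_seminorm M (lin_comb f a k)) \<longlonglongrightarrow> 0"
    by (rule nontrivial_null_series)
  have comb: "lin_comb f (restrict c {1..}) k = lin_comb f c k" for c k
    by (intro lin_comb_cong) auto
  have "?conv (restrict a {1..})" using a(2) by (simp add: dist comb del: One_nat_def)
  moreover have "?conv (restrict (\<lambda>n. 0) {1..})"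
    by (simp add: dist comb lin_comb_eq_zero L2_seminorm_def del: One_nat_def)
  ultimately have "restrict a {1..} = restrict (\<lambda>n. 0) {1..}" by (rule uniq)
  then have "restrict a {1..} 1 = restrict (\<lambda>n. 0) {1..} (1 :: nat)"
    by (rule fun_cong)
  then show False using a(1) by simp
qed

theorem theorem2p4:
  fixes \<nu> :: "complex measure" and \<sigma> :: "int \<Rightarrow> nat"
  assumes "sets \<nu> = sets (restrict_space borel (sphere 0 1))"
    and "finite_measure \<nu>"
    and "discrete_measure \<nu>"
    and "bij_betw \<sigma> UNIV {1..}"
  shows "\<not> schauder_basis (L2_space \<nu>) (\<lambda>n. L2_class \<nu> (\<lambda>z. z powi (inv \<sigma> n)))"
proof -
  have inj: "inj \<sigma>" using assms(4) by (simp add: bij_betw_def)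
  obtain m where m: "\<And>k. k \<le> m k"
    "\<And>i. (\<lambda>k. L2_seminorm \<nu> (\<lambda>z. z powi (i + int (m k)) - z powi i)) \<longlonglongrightarrow> 0"
    using discrete_measure_powers_return[OF assms(1-3)] by blast
  interpret recurrent_sequence \<nu> "\<lambda>n z. z powi (inv \<sigma> n)"
  proof
    show "square_integrable \<nu> (\<lambda>z. z powi (inv \<sigma> n))" for n
      by (rule square_integrable_powi[OF assms(2,1)])
    fix e :: real and N n assume e: "0 < e"
    let ?i = "inv \<sigma> n"
    \<comment> \<open>Only finitely many exponents have index at most \<open>N\<close>, so large ones have index above \<open>N\<close>.\<close>
    have "finite (\<sigma> -` {..N})" using inj by (intro finite_vimageI) auto
    then obtain b where b: "\<And>j. \<sigma> j \<le> N \<Longrightarrow> j \<le> b"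
      by (metis Max_ge atMost_iff vimageI)
    have "eventually (\<lambda>k. L2_seminorm \<nu> (\<lambda>z. z powi (?i + int (m k)) - z powi ?i) < e) sequentially"
      using m(2) e by (rule order_tendstoD(2))
    then have "eventually (\<lambda>k. L2_seminorm \<nu> (\<lambda>z. z powi (?i + int (m k)) - z powi ?i) < e
        \<and> nat (b - ?i) < k) sequentially"
      using eventually_gt_at_top by (rule eventually_conj)
    then obtain k where k: "L2_seminorm \<nu> (\<lambda>z. z powi (?i + int (m k)) - z powi ?i) < e"
      "nat (b - ?i) < k" by (auto simp: eventually_sequentially)
    let ?j = "?i + int (m k)"
    have "b < ?j" using k(2) m(1)[of k] by linarith
    then have "N < \<sigma> ?j" using b[of ?j] by linarith
    then show "\<exists>l>N. L2_seminorm \<nu> (\<lambda>z. z powi (inv \<sigma> l) - z powi (inv \<sigma> n)) < e"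
      using k(1) inv_f_f[OF inj] by (intro exI[of _ "\<sigma> ?j"]) simp
  qed
  show ?thesis by (rule not_schauder_basis)
qed

end
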